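(* For every compactly supported continuous function $f:\mathbb{R}^n\to\mathbb{R}$, the function $$u_f(x):=\int_{\mathbb{R}^n}\Gamma(x,y)f(y)\,dy,\qquad x\in\mathbb{R}^n,$$ is an asymptotic average solution to $\mathcal{L}_a u=-f$ in $\mathbb{R}^n$; that is, $u_f$ is continuous and, for every $x\in\mathbb{R}^n$, the limit $$\mathcal{L}_a u_f(x)=\lim_{r\to 0}\frac{M_r(u_f)(x)-u_f(x)}{Q_r(x)}$$ exists in $\mathbb{R}$ and equals $-f(x)$.
   Context: Setting. Let $\mathcal{L}=\sum_{i,j=1}^n \partial_{x_i}(a_{ij}(x)\partial_{x_j})+\sum_{i=1}^n b_i(x)\partial_{x_i}$ in $\mathbb{R}^n$, with $a_{ij},b_i\in C^\infty(\mathbb{R}^n)$ real-valued. The matrix $A(x)=(a_{ij}(x))$ is symmetric and non-negative definite at every point, and $\inf_{\mathbb{R}^n}a_{11}>0$. Assume $\mathcal{L}$ is hypoelliptic (any distribution $u$ on an open set with $\mathcal{L}u$ smooth is itself smooth) and is endowed with a non-negative smooth fundamental solution $\Gamma:\{(x,y)\in\mathbb{R}^n\times\mathbb{R}^n : x\neq y\}\to\mathbb{R}$ such that: (i) for any fixed $x\in\mathbb{R}^n$, $\Gamma(\cdot,x)$ and $\Gamma(x,\cdot)$ belong to $L^1_{\rm loc}(\mathbb{R}^n)$; (ii) for every $\varphi\in C_0^\infty(\mathbb{R}^n)$ and $x\in\mathbb{R}^n$, $\mathcal{L}\int_{\mathbb{R}^n}\Gamma(x,y)\varphi(y)\,dy=\int_{\mathbb{R}^n}\Gamma(x,y)\mathcal{L}\varphi(y)\,dy=-\varphi(x)$;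 (iii) $\limsup_{x\to y}\Gamma(x,y)=\infty$ for every $y$ and $\limsup_{y\to x}\Gamma(x,y)=\infty$ for every $x$; (iv) for every real $M>0$, $\lim_{|x|\to\infty}\big(\sup_{|y|\le M}\Gamma(x,y)\big)=\lim_{|y|\to\infty}\big(\sup_{|x|\le M}\Gamma(x,y)\big)=0$. For $x\in\mathbb{R}^n$ and $r>0$, the $\mathcal{L}$-ball of center $x$ and radius $r$ is $\Omega_r(x)=\{y\in\mathbb{R}^n,\ y\ne x : \Gamma(x,y)>1/r\}$. Define $$M_r(u)(x)=\frac1r\int_{\Omega_r(x)}u(y)\frac{\langle A(y)\nabla_y\Gamma(x,y),\nabla_y\Gamma(x,y)\rangle}{(\Gamma(x,y))^2}\,dy,$$ $$N_r(w)(x)=\frac1r\int_0^r\left(\int_{\Omega_\rho(x)}\Big(\Gamma(x,y)-\frac1\rho\Big)w(y)\,dy\right)d\rho,$$ and $Q_r(x)=N_r(1)(x)$. It is also assumed that the following Poisson--Jensen-type formula holds: for every open $\Omega\subseteq\mathbb{R}^n$, every $u\in C^2(\Omega)$ and every $\mathcal{L}$-ball with $\overline{\Omega_r(x)}\subseteq\Omega$, $u(x)=M_r(u)(x)-N_r(\mathcal{L}u)(x)$. Definition. For $u,f$ continuous in an open set $\Omega\subseteq\mathbb{R}^n$, $u$ is an asymptotic average solution to $\mathcal{L}u=f$ in $\Omega$ (also written $\mathcal{L}_a u=f$ in $\Omega$) if $\mathcal{L}_a u(x):=\lim_{r\to0}\frac{M_r(u)(x)-u(x)}{Q_r(x)}$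 exists in $\mathbb{R}$ at every $x\in\Omega$ and $\mathcal{L}_a u(x)=f(x)$ for every $x\in\Omega$. *)

theory Defs
  imports "HOL-Analysis.Analysis"
begin

subsection \<open>Smooth functions and distributions\<close>

definition dir_deriv :: "'a::real_normed_vector \<Rightarrow> ('a \<Rightarrow> real) \<Rightarrow> 'a \<Rightarrow> real" where
  "dir_deriv v f x = deriv (\<lambda>t. f (x + t *\<^sub>R v)) 0"

text \<open>
  \<open>Ck_on k S f\<close> is only meant for open \<open>S\<close>: all partial derivatives of order at most \<open>k\<close>
  exist and are continuous on \<open>S\<close>. Values of \<open>f\<close> outside \<open>S\<close> are irrelevant.
\<close>

primrec Ck_on :: "nat \<Rightarrow> 'a::euclidean_space set \<Rightarrow> ('a \<Rightarrow> real) \<Rightarrow> bool" where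
  "Ck_on 0 S f \<longleftrightarrow> continuous_on S f"
| "Ck_on (Suc k) S f \<longleftrightarrow> continuous_on S f \<and>
     (\<forall>v\<in>Basis. (\<forall>x\<in>S. (\<lambda>t. f (x + t *\<^sub>R v)) differentiable (at 0)) \<and> Ck_on k S (dir_deriv v f))"

definition smooth_on :: "'a::euclidean_space set \<Rightarrow> ('a \<Rightarrow> real) \<Rightarrow> bool" where
  "smooth_on S f \<longleftrightarrow> (\<forall>k. Ck_on k S f)"

definition closed_support :: "('a::topological_space \<Rightarrow> real) \<Rightarrow> 'a set" where
  "closed_support f = closure {x. f x \<noteq> 0}"

text \<open>Elements of \<open>C\<^sub>0\<^sup>\<infinity>(U)\<close> are regarded as functions on the whole space, extended by zero.\<close>

definition test_functions :: "'a::euclidean_space set \<Rightarrow> ('a \<Rightarrow> real) set" where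
  "test_functions U =
     {\<phi>. smooth_on UNIV \<phi> \<and> compact (closed_support \<phi>) \<and> closed_support \<phi> \<subseteq> U}"

text \<open>
  A distribution is given by its action on test functions; its value on other functions is
  irrelevant. The seminorms use lists of basis vectors in place of multi-indices.
\<close>

definition iter_deriv :: "'a::real_normed_vector list \<Rightarrow> ('a \<Rightarrow> real) \<Rightarrow> 'a \<Rightarrow> real" where
  "iter_deriv vs f = foldr dir_deriv vs f"

definition distribution_on ::
    "'a::euclidean_space set \<Rightarrow> (('a \<Rightarrow> real) \<Rightarrow> real) \<Rightarrow> bool" where
  "distribution_on U T \<longleftrightarrow>
     (\<forall>\<phi>\<in>test_functions U. \<forall>\<psi>\<in>test_functions U. T (\<lambda>x. \<phi> x + \<psi> x) = T \<phi> + T \<psi>) \<and>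
     (\<forall>c. \<forall>\<phi>\<in>test_functions U. T (\<lambda>x. c * \<phi> x) = c * T \<phi>) \<and>
     (\<forall>K. compact K \<and> K \<subseteq> U \<longrightarrow>
        (\<exists>C N. \<forall>\<phi>\<in>test_functions U. closed_support \<phi> \<subseteq> K \<longrightarrow>
           \<bar>T \<phi>\<bar> \<le> C * (\<Sum>vs | set vs \<subseteq> Basis \<and> length vs \<le> N. SUP x. \<bar>iter_deriv vs \<phi> x\<bar>)))"


subsection \<open>The operator and hypoellipticity\<close>

abbreviation partial :: "'n::finite \<Rightarrow> (real^'n \<Rightarrow> real) \<Rightarrow> real^'n \<Rightarrow> real" where
  "partial i \<equiv> dir_deriv (axis i 1)"

definition grad :: "(real^'n::finite \<Rightarrow> real) \<Rightarrow> real^'n \<Rightarrow> real^'n" where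
  "grad f x = (\<chi> i. partial i f x)"

definition L_op :: "(real^'n::finite \<Rightarrow> real^'n^'n) \<Rightarrow> (real^'n \<Rightarrow> real^'n) \<Rightarrow>
    (real^'n \<Rightarrow> real) \<Rightarrow> real^'n \<Rightarrow> real" where
  "L_op A b u x =
     (\<Sum>i\<in>UNIV. \<Sum>j\<in>UNIV. partial i (\<lambda>z. A z $ i $ j * partial j u z) x)
     + (\<Sum>i\<in>UNIV. b x $ i * partial i u x)"

definition L_adjoint :: "(real^'n::finite \<Rightarrow> real^'n^'n) \<Rightarrow> (real^'n \<Rightarrow> real^'n) \<Rightarrow>
    (real^'n \<Rightarrow> real) \<Rightarrow> real^'n \<Rightarrow> real" where
  "L_adjoint A b \<phi> x =
     (\<Sum>i\<in>UNIV. \<Sum>j\<in>UNIV. partial j (\<lambda>z. A z $ i $ j * partial i \<phi> z) x)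
     - (\<Sum>i\<in>UNIV. partial i (\<lambda>z. b z $ i * \<phi> z) x)"

definition represented_by_on ::
    "'a::euclidean_space set \<Rightarrow> (('a \<Rightarrow> real) \<Rightarrow> real) \<Rightarrow> ('a \<Rightarrow> real) \<Rightarrow> bool" where
  "represented_by_on U T g \<longleftrightarrow> (\<forall>\<phi>\<in>test_functions U. T \<phi> = (LINT x:U|lborel. g x * \<phi> x))"

text \<open>The distribution \<open>L T\<close> is \<open>\<phi> \<mapsto> T (L\<^sup>* \<phi>)\<close>.\<close>

definition hypoelliptic ::
    "(real^'n::finite \<Rightarrow> real^'n^'n) \<Rightarrow> (real^'n \<Rightarrow> real^'n) \<Rightarrow> bool" where
  "hypoelliptic A b \<longleftrightarrow>
     (\<forall>U T. open U \<longrightarrow> distribution_on U T \<longrightarrow>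
        (\<exists>g. smooth_on U g \<and> represented_by_on U (\<lambda>\<phi>. T (L_adjoint A b \<phi>)) g) \<longrightarrow>
        (\<exists>h. smooth_on U h \<and> represented_by_on U T h))"


subsection \<open>Balls, mean value operators, asymptotic average solutions\<close>

text \<open>
  The kernel \<open>\<Gamma>\<close> is a total function, but only its values off the diagonal matter.
\<close>

definition L_ball :: "(real^'n::finite \<Rightarrow> real^'n \<Rightarrow> real) \<Rightarrow> real \<Rightarrow> real^'n \<Rightarrow> (real^'n) set" where
  "L_ball \<Gamma> r x = {y. y \<noteq> x \<and> \<Gamma> x y > 1 / r}"

definition M_mean :: "(real^'n::finite \<Rightarrow> real^'n^'n) \<Rightarrow> (real^'n \<Rightarrow> real^'n \<Rightarrow> real) \<Rightarrow>
    real \<Rightarrow> (real^'n \<Rightarrow> real) \<Rightarrow> real^'n \<Rightarrow> real" where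
  "M_mean A \<Gamma> r u x =
     1 / r * (LINT y:L_ball \<Gamma> r x|lborel.
        u y * (((A y *v grad (\<Gamma> x) y) \<bullet> grad (\<Gamma> x) y) / (\<Gamma> x y)\<^sup>2))"

definition N_mean :: "(real^'n::finite \<Rightarrow> real^'n \<Rightarrow> real) \<Rightarrow>
    real \<Rightarrow> (real^'n \<Rightarrow> real) \<Rightarrow> real^'n \<Rightarrow> real" where
  "N_mean \<Gamma> r w x =
     1 / r * (LINT \<rho>:{0<..<r}|lborel. LINT y:L_ball \<Gamma> \<rho> x|lborel. (\<Gamma> x y - 1 / \<rho>) * w y)"

definition Q_mean :: "(real^'n::finite \<Rightarrow> real^'n \<Rightarrow> real) \<Rightarrow> real \<Rightarrow> real^'n \<Rightarrow> real" where
  "Q_mean \<Gamma> r x = N_mean \<Gamma> r (\<lambda>_. 1) x"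

definition asymptotic_average_solution ::
    "(real^'n::finite \<Rightarrow> real^'n^'n) \<Rightarrow> (real^'n \<Rightarrow> real^'n \<Rightarrow> real) \<Rightarrow>
     (real^'n) set \<Rightarrow> (real^'n \<Rightarrow> real) \<Rightarrow> (real^'n \<Rightarrow> real) \<Rightarrow> bool" where
  "asymptotic_average_solution A \<Gamma> \<Omega> u f \<longleftrightarrow>
     open \<Omega> \<and> continuous_on \<Omega> u \<and> continuous_on \<Omega> f \<and>
     (\<forall>x\<in>\<Omega>. ((\<lambda>r. (M_mean A \<Gamma> r u x - u x) / Q_mean \<Gamma> r x) \<longlongrightarrow> f x) (at_right 0))"

definition potential ::
    "(real^'n::finite \<Rightarrow> real^'n \<Rightarrow> real) \<Rightarrow> (real^'n \<Rightarrow> real) \<Rightarrow> real^'n \<Rightarrow> real" where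
  "potential \<Gamma> f x = (LINT y|lborel. \<Gamma> x y * f y)"

end

theory Submission
  imports Defs
begin

text \<open>
  For a smooth compactly supported right-hand side \<open>\<phi>\<close> the potential \<open>u = potential \<Gamma> \<phi>\<close> is
  \<open>C\<^sup>2\<close> with \<open>L u = - \<phi>\<close>, so the Poisson--Jensen formula reads
  \<open>M\<^sub>r u x - u x = - N\<^sub>r \<phi> x\<close>. Neither side contains a derivative of \<open>u\<close> or \<open>\<phi>\<close> any more, so the
  identity passes to a limit and holds for continuous compactly supported \<open>f\<close> as well, although
  \<open>potential \<Gamma> f\<close> need not be \<open>C\<^sup>2\<close>. Dividing by \<open>Q\<^sub>r x = N\<^sub>r 1 x\<close> turns the right-hand side into
  minus a weighted average of \<open>f\<close> over the ball \<open>\<Omega>\<^sub>r(x)\<close>; the balls shrink to \<open>x\<close>, and the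
  averages tend to \<open>f x\<close> (\<open>N_mean_quotient_tendsto\<close>).

  The limit is kept elementary by a weighted form of approximation (\<open>smooth_approximation\<close>): there
  is one nonnegative test function \<open>\<eta>\<close> such that every \<open>e > 0\<close> admits a test function \<open>\<phi>\<close> with
  \<open>\<bar>\<phi> - f\<bar> \<le> e \<eta>\<close>. The operators \<open>potential \<Gamma>\<close>, \<open>M\<^sub>r\<close> and \<open>N\<^sub>r\<close> are all positive and linear, so
  they turn this bound into \<open>e\<close> times their values at \<open>\<eta>\<close>, resp. at \<open>potential \<Gamma> \<eta>\<close>, and these
  do not depend on \<open>\<phi>\<close>. The bound for the potentials also gives continuity of
  \<open>potential \<Gamma> f\<close>, because \<open>potential \<Gamma> \<eta>\<close> is continuous, hence locally bounded.

  Two integrability questions arise. The kernel of \<open>M\<^sub>r\<close> is integrable over the ball because the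
  Poisson--Jensen formula for \<open>u = 1\<close> says that its integral is \<open>r\<close>, whereas the integral of a
  non-integrable function is \<open>0\<close> by convention. In the outer integral of \<open>N\<^sub>r w\<close> the integrand is
  monotone in the radius when \<open>w \<ge> 0\<close>, hence measurable.
\<close>

section \<open>Smooth approximation\<close>

text \<open>
  Smoothness by coinduction: in a class of continuous functions that is closed under directional
  derivatives, iterated derivatives stay continuous, and none of them has to be computed.
\<close>
lemma smooth_on_UNIV_if_closed_under_dir_deriv:
  assumes cont: "\<And>f. f \<in> S \<Longrightarrow> continuous_on UNIV f"
    and deriv: "\<And>f v. f \<in> S \<Longrightarrow> v \<in> Basis \<Longrightarrow>
      \<exists>g\<in>S. \<forall>x. ((\<lambda>t. f (x + t *\<^sub>R v)) has_real_derivative g x) (at 0)"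
    and "f \<in> S"
  shows "smooth_on UNIV f"
proof -
  have "Ck_on k UNIV f" if "f \<in> S" for k f
    using that
  proof (induction k arbitrary: f)
    case 0
    then show ?case using cont by simp
  next
    case (Suc k)
    have "(\<forall>x. (\<lambda>t. f (x + t *\<^sub>R v)) differentiable (at 0)) \<and> Ck_on k UNIV (dir_deriv v f)"
      if v: "v \<in> Basis" for v
    proof -
      obtain g where g: "g \<in> S"
        and d: "\<And>x. ((\<lambda>t. f (x + t *\<^sub>R v)) has_real_derivative g x) (at 0)"
        using deriv[OF Suc.prems v] by blast
      have "dir_deriv v f = g"
        unfolding dir_deriv_def using DERIV_imp_deriv[OF d] by (intro ext) simp
      then show ?thesis
        using Suc.IH[OF g] d real_differentiable_def by blast
    qed
    then show ?case using cont[OF Suc.prems] by simp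
  qed
  with \<open>f \<in> S\<close> show ?thesis unfolding smooth_on_def by blast
qed

text \<open>
  The powers in the denominator make the family closed under differentiation up to linear
  combinations: the derivative of \<open>exp (- 1 / t) / t ^ m\<close> combines the members \<open>m + 1\<close> and \<open>m + 2\<close>.
\<close>
definition flat :: "nat \<Rightarrow> real \<Rightarrow> real" where
  "flat m t = (if t > 0 then exp (- (1 / t)) / t ^ m else 0)"

text \<open>
  With \<open>s = 1 / t\<close> this is the decay of \<open>s ^ m * exp (- s)\<close>. It holds for all \<open>m\<close>, so it also gives
  the derivative at \<open>0\<close>, where the difference quotient is again a member of the family.
\<close>
lemma flat_tendsto_0: "(flat m \<longlongrightarrow> 0) (at 0)"
proof -
  have "((\<lambda>s::real. s ^ m / exp s) \<longlongrightarrow> 0) at_top"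
    by (rule tendsto_power_div_exp_0)
  then have "((\<lambda>t::real. (inverse t) ^ m / exp (inverse t)) \<longlongrightarrow> 0) (at_right 0)"
    using filterlim_compose filterlim_inverse_at_top_right by blast
  then have right: "(flat m \<longlongrightarrow> 0) (at_right 0)"
  proof (rule Lim_transform_eventually)
    show "\<forall>\<^sub>F t in at_right 0. inverse t ^ m / exp (inverse t) = flat m t"
      unfolding eventually_at_filter
      by (rule always_eventually) (auto simp: flat_def exp_minus field_simps power_inverse)
  qed
  have left: "(flat m \<longlongrightarrow> 0) (at_left 0)"
    by (rule tendsto_eventually) (auto simp: flat_def eventually_at_filter)
  from left right show ?thesis by (simp add: filterlim_split_at)
qed

lemma flat_has_derivative:
  "(flat m has_real_derivative (flat (m + 2) t - real m * flat (m + 1) t)) (at t)"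
proof -
  consider "t > 0" | "t < 0" | "t = 0" by linarith
  then show ?thesis
  proof cases
    case 1
    have "((\<lambda>t. exp (- (1 / t)) / t ^ m) has_real_derivative
        (flat (m + 2) t - real m * flat (m + 1) t)) (at t)"
      using 1 by (auto intro!: derivative_eq_intros simp: flat_def field_simps power2_eq_square)
        (cases m; simp)
    then show ?thesis
      by (rule has_field_derivative_transform_within_open[of _ _ _ "{0<..}"])
        (use 1 in \<open>auto simp: flat_def\<close>)
  next
    case 2
    have "((\<lambda>t. 0) has_real_derivative (flat (m + 2) t - real m * flat (m + 1) t)) (at t)"
      using 2 by (auto simp: flat_def)
    then show ?thesis
      by (rule has_field_derivative_transform_within_open[of _ _ _ "{..<0}"])
        (use 2 in \<open>auto simp: flat_def\<close>)
  next
    case 3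
    have "flat m h / h = flat (m + 1) h" for h
      by (auto simp: flat_def)
    with 3 flat_tendsto_0[of "m + 1"] show ?thesis
      by (simp add: has_field_derivative_iff flat_def[of _ 0])
  qed
qed

text \<open>
  A class containing the polynomials and a bump function, with just enough closure rules for
  smoothness by coinduction.
\<close>
inductive elementary :: "('a::euclidean_space \<Rightarrow> real) \<Rightarrow> bool" where
  linear: "bounded_linear l \<Longrightarrow> elementary l"
| const: "elementary (\<lambda>x. c)"
| add: "elementary f \<Longrightarrow> elementary g \<Longrightarrow> elementary (\<lambda>x. f x + g x)"
| mult: "elementary f \<Longrightarrow> elementary g \<Longrightarrow> elementary (\<lambda>x. f x * g x)"
| flat: "elementary f \<Longrightarrow> elementary (\<lambda>x. flat m (f x))"

lemma elementary_polynomial: "real_polynomial_function p \<Longrightarrow> elementary p"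
  by (induction rule: real_polynomial_function.induct) (auto intro: elementary.intros)

lemma elementary_continuous: "elementary f \<Longrightarrow> continuous_on UNIV f"
proof (induction rule: elementary.induct)
  case (flat f m)
  have "continuous_on UNIV (flat m)"
    using flat_has_derivative DERIV_isCont continuous_at_imp_continuous_on by blast
  from continuous_on_compose2[OF this flat.IH] show ?case by simp
qed (auto intro: continuous_intros linear_continuous_on)

lemma elementary_dir_deriv:
  "elementary f \<Longrightarrow>
    \<exists>g. elementary g \<and> (\<forall>x. ((\<lambda>t. f (x + t *\<^sub>R v)) has_real_derivative g x) (at 0))"
proof (induction rule: elementary.induct)
  case (linear l)
  interpret bounded_linear l by fact
  have "((\<lambda>t. l (x + t *\<^sub>R v)) has_real_derivative l v) (at 0)" for x
    by (auto simp: add scaleR intro!: derivative_eq_intros)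
  then show ?case by (intro exI[of _ "\<lambda>x. l v"]) (auto intro: elementary.const)
next
  case (const c)
  show ?case by (intro exI[of _ "\<lambda>x. 0"]) (auto intro: elementary.const)
next
  case (add f g)
  then obtain f' g' where *: "elementary f'" "elementary g'"
    "\<And>x. ((\<lambda>t. f (x + t *\<^sub>R v)) has_real_derivative f' x) (at 0)"
    "\<And>x. ((\<lambda>t. g (x + t *\<^sub>R v)) has_real_derivative g' x) (at 0)" by blast
  then show ?case
    by (intro exI[of _ "\<lambda>x. f' x + g' x"]) (auto intro: elementary.add DERIV_add)
next
  case (mult f g)
  then obtain f' g' where *: "elementary f'" "elementary g'"
    "\<And>x. ((\<lambda>t. f (x + t *\<^sub>R v)) has_real_derivative f' x) (at 0)"
    "\<And>x. ((\<lambda>t. g (x + t *\<^sub>R v)) has_real_derivative g' x) (at 0)" by blast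
  have "((\<lambda>t. f (x + t *\<^sub>R v) * g (x + t *\<^sub>R v)) has_real_derivative
      (f' x * g x + g' x * f x)) (at 0)" for x
    using DERIV_mult[OF *(3,4), of x] by simp
  with * mult.hyps show ?case
    by (intro exI[of _ "\<lambda>x. f' x * g x + g' x * f x"])
      (auto intro: elementary.add elementary.mult)
next
  case (flat f m)
  then obtain f' where *: "elementary f'"
    "\<And>x. ((\<lambda>t. f (x + t *\<^sub>R v)) has_real_derivative f' x) (at 0)" by blast
  let ?g = "\<lambda>x. (flat (m + 2) (f x) + (- real m) * flat (m + 1) (f x)) * f' x"
  have "((\<lambda>t. flat m (f (x + t *\<^sub>R v))) has_real_derivative ?g x) (at 0)" for x
    using DERIV_chain2[OF flat_has_derivative *(2), of m x] by simp
  moreover have "elementary ?g"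
    using * flat.hyps
    by (intro elementary.add elementary.mult elementary.flat elementary.const)
  ultimately show ?case by blast
qed

lemma elementary_smooth: "elementary f \<Longrightarrow> smooth_on UNIV f"
  by (rule smooth_on_UNIV_if_closed_under_dir_deriv[of "{f. elementary f}"])
    (auto dest: elementary_continuous elementary_dir_deriv)

text \<open>
  The bump \<open>\<eta>\<close> is positive exactly on a ball that contains the support of \<open>f\<close>. The quotient \<open>f / \<eta>\<close>
  is then continuous on the closed ball, and if a polynomial \<open>p\<close> approximates it up to \<open>e\<close>, then
  \<open>\<phi> = \<eta> p\<close> approximates \<open>f\<close> up to \<open>e \<eta>\<close>.
\<close>
lemma smooth_approximation:
  fixes f :: "'a::euclidean_space \<Rightarrow> real"
  assumes cont: "continuous_on UNIV f" and supp: "compact (closed_support f)"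
  obtains \<eta> where "\<eta> \<in> test_functions UNIV"
    and "\<And>e. e > 0 \<Longrightarrow> \<exists>\<phi>\<in>test_functions UNIV. \<forall>x. \<bar>\<phi> x - f x\<bar> \<le> e * \<eta> x"
proof -
  obtain R where R: "R > 0" "closed_support f \<subseteq> ball 0 R"
    using compact_imp_bounded[OF supp] bounded_subset_ballD by blast
  define \<eta> :: "'a \<Rightarrow> real" where "\<eta> x = flat 0 (R\<^sup>2 - (norm x)\<^sup>2)" for x
  have "real_polynomial_function (\<lambda>x::'a. R\<^sup>2 - (\<Sum>i\<in>Basis. (x \<bullet> i) * (x \<bullet> i)))"
    by (intro real_polynomial_function_diff real_polynomial_function_sum
        real_polynomial_function.intros bounded_linear_inner_left) auto
  also have "(\<lambda>x::'a. R\<^sup>2 - (\<Sum>i\<in>Basis. (x \<bullet> i) * (x \<bullet> i))) = (\<lambda>x. R\<^sup>2 - (norm x)\<^sup>2)"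
    by (simp add: power2_norm_eq_inner flip: euclidean_inner)
  finally have \<eta>: "elementary \<eta>"
    unfolding \<eta>_def by (intro elementary.flat elementary_polynomial)
  have pos: "\<eta> x > 0" if "norm x < R" for x
    using that R(1) by (simp add: \<eta>_def flat_def power_strict_mono)
  have zero: "\<eta> x = 0" if "norm x \<ge> R" for x
    using that R(1) by (simp add: \<eta>_def flat_def not_less power_mono)
  have test: "(\<lambda>x. \<eta> x * p x) \<in> test_functions UNIV" if "elementary p" for p
  proof -
    have "{x. \<eta> x * p x \<noteq> 0} \<subseteq> cball 0 R"
      using zero by force
    then have "closed_support (\<lambda>x. \<eta> x * p x) \<subseteq> cball 0 R"
      unfolding closed_support_def by (intro closure_minimal) auto
    then have "compact (closed_support (\<lambda>x. \<eta> x * p x))"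
      using compact_Int_closed[OF compact_cball[of "0::'a" R], of "closed_support (\<lambda>x. \<eta> x * p x)"]
      by (simp add: closed_support_def Int_absorb1)
    then show ?thesis
      unfolding test_functions_def
      using elementary_smooth[OF elementary.mult[OF \<eta> that]] by simp
  qed
  have f_zero: "f x = 0" if "norm x \<ge> R" for x
    using R(2) that closure_subset[of "{x. f x \<noteq> 0}"] by (force simp: closed_support_def)
  \<comment> \<open>On the boundary sphere \<open>\<eta>\<close> vanishes, but there \<open>f\<close> vanishes in a whole neighbourhood and
    \<open>0 / 0 = 0\<close>, so the quotient is continuous there too.\<close>
  have "continuous_on (ball 0 R \<union> - closed_support f) (\<lambda>x. f x / \<eta> x)"
  proof (rule continuous_on_open_Un)
    show "continuous_on (ball 0 R) (\<lambda>x. f x / \<eta> x)"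
    proof (intro continuous_on_divide ballI)
      fix x :: 'a assume "x \<in> ball 0 R"
      then show "\<eta> x \<noteq> 0" using pos[of x] by simp
    qed (auto intro: continuous_on_subset[OF cont] continuous_on_subset[OF elementary_continuous[OF \<eta>]])
    have "f x / \<eta> x = 0" if "x \<in> - closed_support f" for x
      using that closure_subset[of "{x. f x \<noteq> 0}"] by (auto simp: closed_support_def)
    then show "continuous_on (- closed_support f) (\<lambda>x. f x / \<eta> x)"
      using continuous_on_cong[of _ _ "\<lambda>x. f x / \<eta> x" "\<lambda>x. 0"] continuous_on_const by metis
  qed (auto simp: closed_support_def)
  then have quot: "continuous_on (cball 0 R) (\<lambda>x. f x / \<eta> x)"
    by (rule continuous_on_subset) (use R in auto)
  have "\<exists>\<phi>\<in>test_functions UNIV. \<forall>x. \<bar>\<phi> x - f x\<bar> \<le> e * \<eta> x" if "e > 0" for e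
  proof -
    obtain p where p: "real_polynomial_function p"
      and approx: "\<And>x. x \<in> cball 0 R \<Longrightarrow> \<bar>f x / \<eta> x - p x\<bar> < e"
      using Stone_Weierstrass_real_polynomial_function[OF compact_cball quot \<open>e > 0\<close>] by blast
    have "\<bar>\<eta> x * p x - f x\<bar> \<le> e * \<eta> x" for x
    proof (cases "norm x < R")
      case True
      have "\<bar>\<eta> x * p x - f x\<bar> = \<bar>f x / \<eta> x - p x\<bar> * \<eta> x"
        using pos[OF True] by (simp add: field_simps abs_if)
      also have "\<dots> \<le> e * \<eta> x"
        using approx[of x] pos[OF True] True by (intro mult_right_mono) auto
      finally show ?thesis .
    next
      case False
      then show ?thesis using zero f_zero by auto
    qed
    with test[OF elementary_polynomial[OF p]] show ?thesis
      by (intro bexI[of _ "\<lambda>x. \<eta> x * p x"]) auto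
  qed
  moreover have "\<eta> \<in> test_functions UNIV"
    using test[OF elementary.const[of 1]] by simp
  ultimately show ?thesis using that by blast
qed

section \<open>Integrals against a nonnegative kernel\<close>

lemma set_integral_diff_bound:
  fixes a b c :: "'a \<Rightarrow> real"
  assumes "set_integrable M S a" "set_integrable M S b" "set_integrable M S c"
    and "AE x\<in>S in M. \<bar>a x - b x\<bar> \<le> e * c x"
  shows "\<bar>(LINT x:S|M. a x) - (LINT x:S|M. b x)\<bar> \<le> e * (LINT x:S|M. c x)"
proof -
  have d: "set_integrable M S (\<lambda>x. a x - b x)"
    using assms by simp
  have ec: "set_integrable M S (\<lambda>x. e * c x)"
    using assms by simp
  have d': "set_integrable M S (\<lambda>x. b x - a x)"
    using assms by simp
  have "(LINT x:S|M. a x - b x) \<le> (LINT x:S|M. e * c x)"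
    using assms(4) by (intro set_integral_mono_AE d ec) (auto elim!: eventually_mono)
  moreover have "(LINT x:S|M. b x - a x) \<le> (LINT x:S|M. e * c x)"
    using assms(4) by (intro set_integral_mono_AE d' ec) (auto elim!: eventually_mono)
  ultimately show ?thesis
    using assms(1,2) by (simp add: set_integral_diff abs_le_iff)
qed

lemma set_integrable_mult_continuous:
  fixes k w :: "'a::euclidean_space \<Rightarrow> real"
  assumes k: "set_integrable lborel S k" and S: "S \<in> sets borel" "bounded S"
    and w: "continuous_on UNIV w"
  shows "set_integrable lborel S (\<lambda>y. k y * w y)"
proof -
  have "compact (w ` closure S)"
    using S(2) by (intro compact_continuous_image continuous_on_subset[OF w]) auto
  then obtain c where c: "\<And>y. y \<in> closure S \<Longrightarrow> \<bar>w y\<bar> \<le> c"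
    using compact_imp_bounded by (force simp: bounded_iff)
  have [measurable]: "w \<in> borel_measurable borel"
    by (rule borel_measurable_continuous_onI[OF w])
  have k': "integrable lborel (\<lambda>y. indicator S y * k y)"
    using k by (simp add: set_integrable_def)
  have "integrable lborel (\<lambda>y. (indicator S y * k y) * w y)"
  proof (rule Bochner_Integration.integrable_bound)
    show "integrable lborel (\<lambda>y. c * (indicator S y * k y))"
      using k' by simp
    show "(\<lambda>y. indicator S y * k y * w y) \<in> borel_measurable lborel"
      using borel_measurable_integrable[OF k'] by measurable
    have "norm (indicator S y * k y * w y) \<le> norm (c * (indicator S y * k y))" for y
    proof (cases "y \<in> S")
      case True
      then have "\<bar>w y\<bar> \<le> \<bar>c\<bar>" using c[of y] closure_subset by fastforce
      then have "\<bar>k y\<bar> * \<bar>w y\<bar> \<le> \<bar>k y\<bar> * \<bar>c\<bar>" by (rule mult_left_mono) simp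
      with True show ?thesis by (simp add: abs_mult mult.commute)
    qed simp
    then show "AE y in lborel. norm (indicator S y * k y * w y) \<le> norm (c * (indicator S y * k y))"
      by simp
  qed
  then show ?thesis by (simp add: set_integrable_def mult.assoc)
qed

text \<open>
  The form in which positivity of \<open>potential \<Gamma>\<close>, \<open>M\<^sub>r\<close> and \<open>N\<^sub>r\<close> is used. The hypothesis on
  the sign of \<open>k\<close> is only almost everywhere because nothing is known about \<open>\<Gamma> x x\<close>.
\<close>
lemma weighted_set_integral_diff_bound:
  fixes k v w c :: "'a::euclidean_space \<Rightarrow> real"
  assumes k: "set_integrable lborel S k" "AE y\<in>S in lborel. 0 \<le> k y"
    and S: "S \<in> sets borel" "bounded S"
    and cont: "continuous_on UNIV v" "continuous_on UNIV w" "continuous_on UNIV c"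
    and bound: "\<And>y. y \<in> S \<Longrightarrow> \<bar>v y - w y\<bar> \<le> e * c y"
  shows "\<bar>(LINT y:S|lborel. k y * v y) - (LINT y:S|lborel. k y * w y)\<bar>
    \<le> e * (LINT y:S|lborel. k y * c y)"
proof (intro set_integral_diff_bound set_integrable_mult_continuous[OF k(1) S] cont)
  show "AE y\<in>S in lborel. \<bar>k y * v y - k y * w y\<bar> \<le> e * (k y * c y)"
    using k(2)
  proof eventually_elim
    case (elim y)
    show ?case
    proof
      assume "y \<in> S"
      with elim mult_left_mono[OF bound, of y "k y"]
      show "\<bar>k y * v y - k y * w y\<bar> \<le> e * (k y * c y)"
        by (simp add: abs_mult mult.left_commute flip: right_diff_distrib)
    qed
  qed
qed

lemma set_integral_pos_open:
  fixes g :: "'a::euclidean_space \<Rightarrow> real"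
  assumes S: "open S" "S \<noteq> {}" and g: "set_integrable lborel S g" "\<And>y. y \<in> S \<Longrightarrow> g y > 0"
  shows "(LINT y:S|lborel. g y) > 0"
proof -
  have nonneg: "AE y in lborel. 0 \<le> indicator S y * g y"
    using g(2) by (auto simp: indicator_def less_imp_le)
  have int: "integrable lborel (\<lambda>y. indicator S y * g y)"
    using g(1) by (simp add: set_integrable_def)
  have "(LINT y|lborel. indicator S y * g y) \<noteq> 0"
  proof
    assume "(LINT y|lborel. indicator S y * g y) = 0"
    then have "AE y in lborel. indicator S y * g y = 0"
      using integral_nonneg_eq_0_iff_AE[OF int nonneg] by simp
    then have "AE y in lborel. y \<notin> S"
      by eventually_elim (use g(2) in \<open>force simp: indicator_def split: if_splits\<close>)
    then have "S \<in> null_sets lborel"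
      using S(1) by (subst AE_iff_null_sets) auto
    then have "negligible S"
      using negligible_iff_null_sets null_sets_completionI by blast
    then show False using open_not_negligible S by blast
  qed
  moreover have "0 \<le> (LINT y|lborel. indicator S y * g y)"
    by (rule integral_nonneg_AE[OF nonneg])
  ultimately show ?thesis by (simp add: set_lebesgue_integral_def)
qed

section \<open>Averages over the balls of a kernel with a pole\<close>

text \<open>
  What the averages \<open>N\<^sub>r\<close> and the potentials at the point \<open>x\<close> need of \<open>\<Gamma>\<close>. Only the section
  \<open>\<Gamma> x\<close> is constrained; \<open>\<Gamma>\<close> itself is the parameter because \<open>L_ball\<close>, \<open>N_mean\<close> and \<open>potential\<close> expect it.
\<close>
locale pole_kernel =
  fixes \<Gamma> :: "real^'n::finite \<Rightarrow> real^'n \<Rightarrow> real" and x :: "real^'n"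
  assumes cont: "continuous_on (- {x}) (\<Gamma> x)"
    and nonneg: "\<And>y. y \<noteq> x \<Longrightarrow> 0 \<le> \<Gamma> x y"
    and L1loc: "\<And>K. compact K \<Longrightarrow> set_integrable lborel K (\<Gamma> x)"
    and pole: "Limsup (at x) (\<lambda>y. ereal (\<Gamma> x y)) = \<infinity>"
    and vanish: "(\<Gamma> x \<longlongrightarrow> 0) at_infinity"
begin

abbreviation ball_int :: "(real^'n \<Rightarrow> real) \<Rightarrow> real \<Rightarrow> real" where
  "ball_int w \<rho> \<equiv> LINT y:L_ball \<Gamma> \<rho> x|lborel. (\<Gamma> x y - 1 / \<rho>) * w y"

lemma open_L_ball: "open (L_ball \<Gamma> \<rho> x)"
proof -
  have "L_ball \<Gamma> \<rho> x = - {x} \<inter> \<Gamma> x -` {1 / \<rho><..}"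
    by (auto simp: L_ball_def)
  then show ?thesis
    using continuous_open_preimage[OF cont, of "{1 / \<rho><..}"] by (simp add: open_Compl)
qed

lemma L_ball_mono:
  assumes "0 < \<rho>" "\<rho> \<le> r"
  shows "L_ball \<Gamma> \<rho> x \<subseteq> L_ball \<Gamma> r x"
  using frac_le[of 1 1 \<rho> r] assms by (fastforce simp: L_ball_def)

lemma bounded_L_ball:
  assumes "\<rho> > 0"
  shows "bounded (L_ball \<Gamma> \<rho> x)"
proof -
  have "eventually (\<lambda>y. \<Gamma> x y < 1 / \<rho>) at_infinity"
    using order_tendstoD(2)[OF vanish] assms by simp
  then obtain R where R: "\<And>y. norm y \<ge> R \<Longrightarrow> \<Gamma> x y < 1 / \<rho>"
    by (auto simp: eventually_at_infinity)
  have "L_ball \<Gamma> \<rho> x \<subseteq> cball 0 R"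
  proof
    fix y assume "y \<in> L_ball \<Gamma> \<rho> x"
    then show "y \<in> cball 0 R" using R[of y] by (cases "R \<le> norm y") (auto simp: L_ball_def)
  qed
  then show ?thesis using bounded_subset bounded_cball by blast
qed

text \<open>
  An empty ball would bound \<open>\<Gamma> x\<close> near its pole. This is what makes \<open>Q\<^sub>r\<close> positive.
\<close>
lemma L_ball_nonempty: "L_ball \<Gamma> \<rho> x \<noteq> {}"
proof
  assume *: "L_ball \<Gamma> \<rho> x = {}"
  have "eventually (\<lambda>y. ereal (\<Gamma> x y) \<le> ereal (1 / \<rho>)) (at x)"
    unfolding eventually_at_filter
    by (rule always_eventually) (use * in \<open>auto simp: L_ball_def\<close>)
  from Limsup_bounded[OF this] pole show False by simp
qed

text \<open>
  Away from \<open>x\<close> the kernel is bounded: near infinity by its decay, in between by compactness.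
  A bound \<open>C\<close> outside \<open>ball x \<delta>\<close> gives the inclusion as soon as \<open>1 / r > C\<close>.
\<close>
lemma L_ball_shrinks:
  assumes "\<delta> > 0"
  shows "\<forall>\<^sub>F r in at_right 0. L_ball \<Gamma> r x \<subseteq> ball x \<delta>"
proof -
  have "eventually (\<lambda>y. \<Gamma> x y < 1) at_infinity"
    using order_tendstoD(2)[OF vanish] by simp
  then obtain R where R: "\<And>y. norm y \<ge> R \<Longrightarrow> \<Gamma> x y < 1"
    by (auto simp: eventually_at_infinity)
  have "compact (cball 0 R - ball x \<delta>)"
    by (intro compact_diff) auto
  then have "compact (\<Gamma> x ` (cball 0 R - ball x \<delta>))"
    using assms by (intro compact_continuous_image continuous_on_subset[OF cont]) auto
  then obtain B where B: "\<And>y. y \<in> cball 0 R - ball x \<delta> \<Longrightarrow> \<bar>\<Gamma> x y\<bar> \<le> B"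
    using compact_imp_bounded by (force simp: bounded_iff)
  define C where "C = max 1 B"
  have C: "\<Gamma> x y \<le> C" if "y \<notin> ball x \<delta>" for y
  proof (cases "norm y \<ge> R")
    case True
    then show ?thesis using R[of y] by (simp add: C_def)
  next
    case False
    then show ?thesis using B[of y] that by (simp add: C_def)
  qed
  have "C > 0" by (simp add: C_def)
  then have "\<forall>\<^sub>F r in at_right 0. r \<in> {0<..<1 / C}"
    by (intro eventually_at_right_real) simp
  then show ?thesis
  proof eventually_elim
    case (elim r)
    then have "C < 1 / r" using \<open>C > 0\<close> by (simp add: field_simps)
    then show ?case using C by (force simp: L_ball_def)
  qed
qed

lemma ball_kernel_integrable:
  assumes "\<rho> > 0"
  shows "set_integrable lborel (L_ball \<Gamma> \<rho> x) (\<lambda>y. \<Gamma> x y - 1 / \<rho>)"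
proof -
  have K: "compact (closure (L_ball \<Gamma> \<rho> x))"
    using bounded_L_ball[OF assms] by simp
  have "set_integrable lborel (closure (L_ball \<Gamma> \<rho> x)) (\<lambda>y. 1 / \<rho>)"
    unfolding set_integrable_def by (intro borel_integrable_compact K continuous_on_const)
  then have "set_integrable lborel (closure (L_ball \<Gamma> \<rho> x)) (\<lambda>y. \<Gamma> x y - 1 / \<rho>)"
    by (intro set_integral_diff L1loc K)
  then show ?thesis
    by (rule set_integrable_subset)
      (use open_L_ball in \<open>auto intro: closure_subset[THEN subsetD]\<close>)
qed

lemma ball_int_integrable:
  assumes "\<rho> > 0" "continuous_on UNIV w"
  shows "set_integrable lborel (L_ball \<Gamma> \<rho> x) (\<lambda>y. (\<Gamma> x y - 1 / \<rho>) * w y)"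
  using open_L_ball assms
  by (intro set_integrable_mult_continuous ball_kernel_integrable bounded_L_ball) auto

text \<open>
  As the radius grows, both the ball and the integrand \<open>\<Gamma> x y - 1 / \<rho>\<close> grow.
\<close>
lemma ball_int_mono:
  assumes "0 < \<rho>" "\<rho> \<le> r" and w: "continuous_on UNIV w" "\<And>y. 0 \<le> w y"
  shows "ball_int w \<rho> \<le> ball_int w r"
  unfolding set_lebesgue_integral_def
proof (intro integral_mono)
  show "integrable lborel (\<lambda>y. indicator (L_ball \<Gamma> \<rho> x) y *\<^sub>R ((\<Gamma> x y - 1 / \<rho>) * w y))"
    "integrable lborel (\<lambda>y. indicator (L_ball \<Gamma> r x) y *\<^sub>R ((\<Gamma> x y - 1 / r) * w y))"
    using ball_int_integrable[OF _ w(1)] assms by (auto simp: set_integrable_def)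
  fix y
  have "1 / r \<le> 1 / \<rho>" using assms by (simp add: frac_le)
  then have le: "(\<Gamma> x y - 1 / \<rho>) * w y \<le> (\<Gamma> x y - 1 / r) * w y"
    using w(2)[of y] by (intro mult_right_mono) auto
  show "indicator (L_ball \<Gamma> \<rho> x) y *\<^sub>R ((\<Gamma> x y - 1 / \<rho>) * w y)
      \<le> indicator (L_ball \<Gamma> r x) y *\<^sub>R ((\<Gamma> x y - 1 / r) * w y)"
  proof (cases "y \<in> L_ball \<Gamma> \<rho> x")
    case True
    then have "y \<in> L_ball \<Gamma> r x" using L_ball_mono[OF assms(1,2)] by blast
    with True le show ?thesis by simp
  next
    case False
    then show ?thesis
      using w(2)[of y] by (cases "y \<in> L_ball \<Gamma> r x") (auto simp: L_ball_def)
  qed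
qed

lemma ball_int_diff_bound:
  assumes "\<rho> > 0" "continuous_on UNIV v" "continuous_on UNIV w" "continuous_on UNIV c"
    and "\<And>y. y \<in> L_ball \<Gamma> \<rho> x \<Longrightarrow> \<bar>v y - w y\<bar> \<le> e * c y"
  shows "\<bar>ball_int v \<rho> - ball_int w \<rho>\<bar> \<le> e * ball_int c \<rho>"
  using assms open_L_ball
  by (intro weighted_set_integral_diff_bound ball_kernel_integrable bounded_L_ball)
    (auto simp: L_ball_def)

lemma outer_integrable_nonneg:
  assumes w: "continuous_on UNIV w" "\<And>y. 0 \<le> w y" and "r > 0"
  shows "set_integrable lborel {0<..<r} (ball_int w)"
proof -
  have bound: "0 \<le> ball_int w \<rho> \<and> ball_int w \<rho> \<le> ball_int w r" if "\<rho> \<in> {0<..<r}" for \<rho>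
  proof
    show "0 \<le> ball_int w \<rho>"
      unfolding set_lebesgue_integral_def
      by (rule Bochner_Integration.integral_nonneg) (simp add: L_ball_def indicator_def w(2))
    show "ball_int w \<rho> \<le> ball_int w r"
      by (rule ball_int_mono) (use that w in auto)
  qed
  have "mono_on {0<..<r} (ball_int w)"
    by (intro mono_onI ball_int_mono w) auto
  then have "ball_int w \<in> borel_measurable (restrict_space borel {0<..<r})"
    by (rule borel_measurable_mono_on_fnc)
  then have meas: "(\<lambda>\<rho>. indicator {0<..<r} \<rho> *\<^sub>R ball_int w \<rho>) \<in> borel_measurable borel"
    by (subst (asm) borel_measurable_restrict_space_iff) auto
  show ?thesis
    unfolding set_integrable_def
  proof (rule Bochner_Integration.integrable_bound)
    show "integrable lborel (\<lambda>\<rho>. indicator {0<..<r} \<rho> *\<^sub>R ball_int w r)"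
      by (intro integrable_scaleR_left integrable_real_indicator) (use \<open>r > 0\<close> in auto)
    show "(\<lambda>\<rho>. indicator {0<..<r} \<rho> *\<^sub>R ball_int w \<rho>) \<in> borel_measurable lborel"
      using meas by simp
    have "norm (indicator {0<..<r} \<rho> *\<^sub>R ball_int w \<rho>)
        \<le> norm (indicator {0<..<r} \<rho> *\<^sub>R ball_int w r)" for \<rho>
      by (cases "\<rho> \<in> {0<..<r}") (use bound[of \<rho>] in auto)
    then show "AE \<rho> in lborel. norm (indicator {0<..<r} \<rho> *\<^sub>R ball_int w \<rho>)
        \<le> norm (indicator {0<..<r} \<rho> *\<^sub>R ball_int w r)"
      by simp
  qed
qed

text \<open>
  Monotonicity in the radius requires a sign, hence the split into positive and negative part.
\<close>
lemma outer_integrable: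
  assumes w: "continuous_on UNIV w" and "r > 0"
  shows "set_integrable lborel {0<..<r} (ball_int w)"
proof -
  let ?p = "\<lambda>y. max (w y) 0" and ?m = "\<lambda>y. max (- w y) 0"
  have c: "continuous_on UNIV ?p" "continuous_on UNIV ?m"
    using w by (auto intro!: continuous_intros)
  have "set_integrable lborel {0<..<r} (\<lambda>\<rho>. ball_int ?p \<rho> - ball_int ?m \<rho>)"
    using c \<open>r > 0\<close> by (intro set_integral_diff outer_integrable_nonneg) auto
  moreover have "ball_int ?p \<rho> - ball_int ?m \<rho> = ball_int w \<rho>" if "\<rho> \<in> {0<..<r}" for \<rho>
  proof -
    have "ball_int ?p \<rho> - ball_int ?m \<rho> =
        (LINT y:L_ball \<Gamma> \<rho> x|lborel. (\<Gamma> x y - 1 / \<rho>) * ?p y - (\<Gamma> x y - 1 / \<rho>) * ?m y)"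
      by (intro set_integral_diff(2)[symmetric] ball_int_integrable c) (use that in auto)
    also have "(\<lambda>y. (\<Gamma> x y - 1 / \<rho>) * ?p y - (\<Gamma> x y - 1 / \<rho>) * ?m y)
        = (\<lambda>y. (\<Gamma> x y - 1 / \<rho>) * w y)"
      by (auto simp: max_def)
    finally show ?thesis .
  qed
  ultimately show ?thesis
    using set_integrable_cong[OF refl refl,
        of "{0<..<r}" "\<lambda>\<rho>. ball_int ?p \<rho> - ball_int ?m \<rho>" "ball_int w" lborel]
    by blast
qed

lemma N_mean_diff_bound:
  assumes "r > 0" "continuous_on UNIV v" "continuous_on UNIV w" "continuous_on UNIV c"
    and "\<And>y. y \<in> L_ball \<Gamma> r x \<Longrightarrow> \<bar>v y - w y\<bar> \<le> e * c y"
  shows "\<bar>N_mean \<Gamma> r v x - N_mean \<Gamma> r w x\<bar> \<le> e * N_mean \<Gamma> r c x"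
proof -
  have "\<bar>ball_int v \<rho> - ball_int w \<rho>\<bar> \<le> e * ball_int c \<rho>" if "\<rho> \<in> {0<..<r}" for \<rho>
    by (rule ball_int_diff_bound) (use that assms L_ball_mono[of \<rho> r] in auto)
  then have bound: "\<bar>(LINT \<rho>:{0<..<r}|lborel. ball_int v \<rho>) - (LINT \<rho>:{0<..<r}|lborel. ball_int w \<rho>)\<bar>
      \<le> e * (LINT \<rho>:{0<..<r}|lborel. ball_int c \<rho>)"
    by (intro set_integral_diff_bound outer_integrable assms) auto
  have "\<bar>N_mean \<Gamma> r v x - N_mean \<Gamma> r w x\<bar> =
      1 / r * \<bar>(LINT \<rho>:{0<..<r}|lborel. ball_int v \<rho>) - (LINT \<rho>:{0<..<r}|lborel. ball_int w \<rho>)\<bar>"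
    unfolding N_mean_def right_diff_distrib[symmetric] abs_mult using \<open>r > 0\<close> by simp
  also have "\<dots> \<le> 1 / r * (e * (LINT \<rho>:{0<..<r}|lborel. ball_int c \<rho>))"
    using \<open>r > 0\<close> by (intro mult_left_mono[OF bound]) simp
  also have "\<dots> = e * N_mean \<Gamma> r c x"
    unfolding N_mean_def by (rule mult.left_commute)
  finally show ?thesis .
qed

lemma N_mean_cmult: "N_mean \<Gamma> r (\<lambda>y. c * w y) x = c * N_mean \<Gamma> r w x"
  unfolding N_mean_def by (simp add: mult.left_commute[of _ c])

lemma Q_mean_pos:
  assumes "r > 0"
  shows "Q_mean \<Gamma> r x > 0"
proof -
  have "ball_int (\<lambda>_. 1) \<rho> > 0" if "\<rho> > 0" for \<rho>
    using that
    by (intro set_integral_pos_open[OF open_L_ball L_ball_nonempty] ball_int_integrable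
        continuous_on_const) (auto simp: L_ball_def)
  then have "(LINT \<rho>:{0<..<r}|lborel. ball_int (\<lambda>_. 1) \<rho>) > 0"
    using assms
    by (intro set_integral_pos_open[of "{0<..<r}"] outer_integrable continuous_on_const) auto
  then show ?thesis using assms by (simp add: Q_mean_def N_mean_def)
qed

text \<open>
  \<open>N\<^sub>r w x / Q\<^sub>r x\<close> is an average of \<open>w\<close> over a ball on which, for small \<open>r\<close>, the function \<open>w\<close> is
  nearly the constant \<open>w x\<close>.
\<close>
lemma N_mean_quotient_tendsto:
  assumes w: "continuous_on UNIV w"
  shows "((\<lambda>r. N_mean \<Gamma> r w x / Q_mean \<Gamma> r x) \<longlongrightarrow> w x) (at_right 0)"
proof (rule tendstoI)
  fix e :: real assume "e > 0"
  obtain \<delta> where \<delta>: "\<delta> > 0" "\<And>y. dist y x < \<delta> \<Longrightarrow> dist (w y) (w x) < e / 2"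
    using w[unfolded continuous_on_iff, rule_format, of x "e / 2"] \<open>e > 0\<close> by auto
  have "\<forall>\<^sub>F r in at_right 0. r > (0::real)"
    by (rule eventually_at_right_less)
  with L_ball_shrinks[OF \<delta>(1)]
  show "\<forall>\<^sub>F r in at_right 0. dist (N_mean \<Gamma> r w x / Q_mean \<Gamma> r x) (w x) < e"
  proof eventually_elim
    case (elim r)
    have Q: "Q_mean \<Gamma> r x > 0" using Q_mean_pos elim by simp
    \<comment> \<open>The factor \<open>1\<close> lets \<open>N_mean_cmult\<close> rewrite the mean of a constant as a multiple of \<open>Q\<^sub>r\<close>.\<close>
    have "\<bar>N_mean \<Gamma> r w x - N_mean \<Gamma> r (\<lambda>_. w x * 1) x\<bar> \<le> e / 2 * N_mean \<Gamma> r (\<lambda>_. 1) x"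
      using elim \<delta>(2) w
      by (intro N_mean_diff_bound)
        (auto simp: dist_real_def subset_iff dist_commute less_imp_le)
    then have "\<bar>N_mean \<Gamma> r w x - w x * Q_mean \<Gamma> r x\<bar> \<le> e / 2 * Q_mean \<Gamma> r x"
      by (simp only: N_mean_cmult Q_mean_def)
    also have "\<dots> < e * Q_mean \<Gamma> r x" using Q \<open>e > 0\<close> by simp
    finally have "\<bar>N_mean \<Gamma> r w x - w x * Q_mean \<Gamma> r x\<bar> / Q_mean \<Gamma> r x < e"
      using Q by (simp add: divide_less_eq)
    moreover have "N_mean \<Gamma> r w x / Q_mean \<Gamma> r x - w x
        = (N_mean \<Gamma> r w x - w x * Q_mean \<Gamma> r x) / Q_mean \<Gamma> r x"
      using Q by (simp add: field_simps)
    ultimately show ?case using Q by (simp add: dist_real_def)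
  qed
qed

lemma potential_eq_set_integral:
  assumes "closed_support w \<subseteq> K"
  shows "potential \<Gamma> w x = (LINT y:K|lborel. \<Gamma> x y * w y)"
proof -
  have "w y = 0" if "y \<notin> K" for y
    using that assms closure_subset[of "{x. w x \<noteq> 0}"] by (auto simp: closed_support_def)
  then show ?thesis
    unfolding potential_def set_lebesgue_integral_def
    by (intro Bochner_Integration.integral_cong refl) (auto simp: indicator_def)
qed

lemma potential_diff_bound:
  assumes supp: "compact (closed_support v)" "compact (closed_support w)" "compact (closed_support c)"
    and cont: "continuous_on UNIV v" "continuous_on UNIV w" "continuous_on UNIV c"
    and bound: "\<And>y. \<bar>v y - w y\<bar> \<le> e * c y"
  shows "\<bar>potential \<Gamma> v x - potential \<Gamma> w x\<bar> \<le> e * potential \<Gamma> c x"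
proof -
  define K where "K = closed_support v \<union> closed_support w \<union> closed_support c"
  have K: "compact K" using supp by (auto simp: K_def)
  have "AE y in lborel. y \<noteq> x" by (rule AE_lborel_singleton)
  then have "AE y\<in>K in lborel. 0 \<le> \<Gamma> x y"
    by eventually_elim (use nonneg in auto)
  then have "\<bar>(LINT y:K|lborel. \<Gamma> x y * v y) - (LINT y:K|lborel. \<Gamma> x y * w y)\<bar>
      \<le> e * (LINT y:K|lborel. \<Gamma> x y * c y)"
    using K compact_imp_bounded[OF K] compact_imp_closed[OF K] cont bound
    by (intro weighted_set_integral_diff_bound L1loc) auto
  moreover have "potential \<Gamma> u x = (LINT y:K|lborel. \<Gamma> x y * u y)" if "u \<in> {v, w, c}" for u
    using that by (intro potential_eq_set_integral) (auto simp: K_def)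
  ultimately show ?thesis by simp
qed

end

section \<open>The asymptotic average equation\<close>

text \<open>
  The weight \<open>C\<close> is locally bounded by continuity, so the approximation is locally uniform.
\<close>
lemma continuous_on_weighted_uniform_limit:
  fixes u C :: "'a::metric_space \<Rightarrow> real"
  assumes C: "continuous_on UNIV C"
    and approx: "\<And>e. e > 0 \<Longrightarrow> \<exists>v. continuous_on UNIV v \<and> (\<forall>x. \<bar>v x - u x\<bar> \<le> e * C x)"
  shows "continuous_on UNIV u"
  unfolding continuous_on_def
proof (intro ballI tendstoI)
  fix x and \<epsilon> :: real assume "\<epsilon> > 0"
  define K where "K = \<bar>C x\<bar> + 1"
  have K: "K > 0" by (simp add: K_def)
  define e where "e = \<epsilon> / (3 * K)"
  have e: "e > 0" "e * K = \<epsilon> / 3" using K \<open>\<epsilon> > 0\<close> by (auto simp: e_def)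
  obtain v where v: "continuous_on UNIV v" "\<And>y. \<bar>v y - u y\<bar> \<le> e * C y"
    using approx[OF e(1)] by blast
  have "(C \<longlongrightarrow> C x) (at x)" "(v \<longlongrightarrow> v x) (at x)"
    using C v(1) by (auto simp: continuous_on_def)
  then have "\<forall>\<^sub>F y in at x. C y < K" "\<forall>\<^sub>F y in at x. dist (v y) (v x) < \<epsilon> / 3"
    using order_tendstoD(2)[of C "C x" "at x" K] tendstoD[of v "v x" "at x" "\<epsilon> / 3"] \<open>\<epsilon> > 0\<close>
    by (auto simp: K_def)
  then show "\<forall>\<^sub>F y in at x. dist (u y) (u x) < \<epsilon>"
  proof eventually_elim
    case (elim y)
    have "e * C y < \<epsilon> / 3" "e * C x < \<epsilon> / 3"
      using mult_strict_left_mono[OF elim(1) e(1)] mult_strict_left_mono[of "C x" K e] e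
      by (auto simp: K_def)
    with v(2)[of x] v(2)[of y] elim(2) show ?case
      unfolding dist_real_def by linarith
  qed
qed

lemma real_eq_0_if_le_small_multiples:
  fixes d K :: real
  assumes "\<And>e. e > 0 \<Longrightarrow> \<bar>d\<bar> \<le> e * K"
  shows "d = 0"
proof (rule ccontr)
  assume "d \<noteq> 0"
  define e where "e = \<bar>d\<bar> / (2 * (\<bar>K\<bar> + 1))"
  have "e > 0" using \<open>d \<noteq> 0\<close> by (simp add: e_def add_nonneg_pos)
  have "\<bar>d\<bar> \<le> e * K" by (rule assms[OF \<open>e > 0\<close>])
  also have "\<dots> \<le> e * (\<bar>K\<bar> + 1)" using \<open>e > 0\<close> by (intro mult_left_mono) auto
  also have "\<dots> = \<bar>d\<bar> / 2" by (simp add: e_def field_simps)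
  finally show False using \<open>d \<noteq> 0\<close> by simp
qed

lemma continuous_on_test_function: "\<phi> \<in> test_functions U \<Longrightarrow> continuous_on UNIV \<phi>"
  unfolding test_functions_def smooth_on_def using Ck_on.simps(1) by blast

lemma compact_support_test_function: "\<phi> \<in> test_functions U \<Longrightarrow> compact (closed_support \<phi>)"
  by (simp add: test_functions_def)

lemma Ck_on_imp_continuous_on: "Ck_on k S f \<Longrightarrow> continuous_on S f"
  by (cases k) auto

theorem theorem1p2:
  fixes A :: "real^'n::finite \<Rightarrow> real^'n^'n"
    and b :: "real^'n \<Rightarrow> real^'n"
    and \<Gamma> :: "real^'n \<Rightarrow> real^'n \<Rightarrow> real"
    and i\<^sub>1 :: 'n
    and f :: "real^'n \<Rightarrow> real"
  assumes A_smooth: "\<And>i j. smooth_on UNIV (\<lambda>x. A x $ i $ j)"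
    and b_smooth: "\<And>i. smooth_on UNIV (\<lambda>x. b x $ i)"
    and A_symmetric: "\<And>x. transpose (A x) = A x"
    and A_nonneg: "\<And>x v. 0 \<le> (A x *v v) \<bullet> v"
    and A_nondegenerate: "(INF x. A x $ i\<^sub>1 $ i\<^sub>1) > 0"
    and L_hypoelliptic: "hypoelliptic A b"
    and Gamma_smooth: "smooth_on {(x, y). x \<noteq> y} (\<lambda>(x, y). \<Gamma> x y)"
    and Gamma_nonneg: "\<And>x y. x \<noteq> y \<Longrightarrow> 0 \<le> \<Gamma> x y"
    and Gamma_L1loc: "\<And>x K. compact K \<Longrightarrow> set_integrable lborel K (\<lambda>y. \<Gamma> y x)"
      "\<And>x K. compact K \<Longrightarrow> set_integrable lborel K (\<lambda>y. \<Gamma> x y)"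
    and Gamma_potential_C2: "\<And>\<phi>. \<phi> \<in> test_functions UNIV \<Longrightarrow> Ck_on 2 UNIV (potential \<Gamma> \<phi>)"
    and Gamma_inverse: "\<And>\<phi> x. \<phi> \<in> test_functions UNIV \<Longrightarrow> L_op A b (potential \<Gamma> \<phi>) x = - \<phi> x"
      "\<And>\<phi> x. \<phi> \<in> test_functions UNIV \<Longrightarrow> potential \<Gamma> (L_op A b \<phi>) x = - \<phi> x"
    and Gamma_pole: "\<And>y. Limsup (at y) (\<lambda>x. ereal (\<Gamma> x y)) = \<infinity>"
      "\<And>x. Limsup (at x) (\<lambda>y. ereal (\<Gamma> x y)) = \<infinity>"
    and Gamma_vanishing:
      "\<And>M. M > 0 \<Longrightarrow> ((\<lambda>x. SUP y\<in>cball 0 M. \<Gamma> x y) \<longlongrightarrow> 0) at_infinity"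
      "\<And>M. M > 0 \<Longrightarrow> ((\<lambda>y. SUP x\<in>cball 0 M. \<Gamma> x y) \<longlongrightarrow> 0) at_infinity"
    and Poisson_Jensen: "\<And>\<Omega> u x r. \<lbrakk>open \<Omega>; Ck_on 2 \<Omega> u; r > 0; closure (L_ball \<Gamma> r x) \<subseteq> \<Omega>\<rbrakk>
      \<Longrightarrow> u x = M_mean A \<Gamma> r u x - N_mean \<Gamma> r (L_op A b u) x"
    and f_continuous: "continuous_on UNIV f"
    and f_compact_support: "compact (closed_support f)"
  shows "asymptotic_average_solution A \<Gamma> UNIV (potential \<Gamma> f) (\<lambda>x. - f x)"
proof -
  have Gamma_cont: "continuous_on {(x, y). x \<noteq> y} (\<lambda>(x, y). \<Gamma> x y)"
    using Gamma_smooth unfolding smooth_on_def using Ck_on.simps(1) by blast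
  have pole: "pole_kernel \<Gamma> x" for x
  proof
    have "continuous_on (- {x}) (\<lambda>y. (x, y))"
      by (intro continuous_intros)
    from continuous_on_compose2[OF Gamma_cont this] show "continuous_on (- {x}) (\<Gamma> x)"
      by auto
    show "(\<Gamma> x \<longlongrightarrow> 0) at_infinity"
    proof -
      define M where "M = norm x + 1"
      have M: "M > 0" by (simp add: M_def add_nonneg_pos)
      have lim: "((\<lambda>y. SUP x\<in>cball 0 M. \<Gamma> x y) \<longlongrightarrow> 0) at_infinity"
        using M by (rule Gamma_vanishing)
      have "0 \<le> \<Gamma> x y \<and> \<Gamma> x y \<le> (SUP x\<in>cball 0 M. \<Gamma> x y)" if "norm y \<ge> M + 1" for y
      proof
        show "0 \<le> \<Gamma> x y"
          using that by (intro Gamma_nonneg) (auto simp: M_def)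
        \<comment> \<open>An unbounded supremum of reals would be a junk value, so boundedness must be checked.\<close>
        have "continuous_on (cball 0 M) (\<lambda>x. (x, y))"
          by (intro continuous_intros)
        moreover have "(\<lambda>x. (x, y)) ` cball 0 M \<subseteq> {(x, y). x \<noteq> y}"
          using that by auto
        ultimately have "continuous_on (cball 0 M) (\<lambda>x. \<Gamma> x y)"
          using continuous_on_compose2[OF Gamma_cont] by fastforce
        then have "bdd_above ((\<lambda>x. \<Gamma> x y) ` cball 0 M)"
          by (intro bounded_imp_bdd_above compact_imp_bounded compact_continuous_image) auto
        then show "\<Gamma> x y \<le> (SUP x\<in>cball 0 M. \<Gamma> x y)"
          by (intro cSUP_upper) (auto simp: M_def)
      qed
      then have "\<forall>\<^sub>F y in at_infinity. 0 \<le> \<Gamma> x y"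
        "\<forall>\<^sub>F y in at_infinity. \<Gamma> x y \<le> (SUP x\<in>cball 0 M. \<Gamma> x y)"
        unfolding eventually_at_infinity by blast+
      then show ?thesis
        by (rule tendsto_sandwich[OF _ _ tendsto_const lim])
    qed
  qed (use Gamma_nonneg Gamma_L1loc(2) Gamma_pole(2) in auto)

  obtain \<eta> where \<eta>: "\<eta> \<in> test_functions UNIV"
    and approx: "\<And>e. e > 0 \<Longrightarrow> \<exists>\<phi>\<in>test_functions UNIV. \<forall>x. \<bar>\<phi> x - f x\<bar> \<le> e * \<eta> x"
    using smooth_approximation[OF f_continuous f_compact_support] by blast
  note test_cont = continuous_on_test_function and test_supp = compact_support_test_function
  have C2_cont: "continuous_on UNIV (potential \<Gamma> \<phi>)" if "\<phi> \<in> test_functions UNIV" for \<phi>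
    using Gamma_potential_C2[OF that] by (rule Ck_on_imp_continuous_on)
  have potential_approx: "\<bar>potential \<Gamma> \<phi> x - potential \<Gamma> f x\<bar> \<le> e * potential \<Gamma> \<eta> x"
    if "\<phi> \<in> test_functions UNIV" "\<And>x. \<bar>\<phi> x - f x\<bar> \<le> e * \<eta> x" for \<phi> e x
    using that \<eta> f_continuous f_compact_support
    by (intro pole_kernel.potential_diff_bound[OF pole]) (auto intro: test_cont test_supp)
  have u_cont: "continuous_on UNIV (potential \<Gamma> f)"
  proof (rule continuous_on_weighted_uniform_limit[OF C2_cont[OF \<eta>]])
    fix e :: real assume "e > 0"
    then obtain \<phi> where "\<phi> \<in> test_functions UNIV" "\<And>x. \<bar>\<phi> x - f x\<bar> \<le> e * \<eta> x"
      using approx by blast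
    then show "\<exists>v. continuous_on UNIV v \<and> (\<forall>x. \<bar>v x - potential \<Gamma> f x\<bar> \<le> e * potential \<Gamma> \<eta> x)"
      using C2_cont potential_approx by blast
  qed

  have identity: "M_mean A \<Gamma> r (potential \<Gamma> f) x - potential \<Gamma> f x = - N_mean \<Gamma> r f x"
    if "r > 0" for r x
  proof -
    interpret pole_kernel \<Gamma> x by (rule pole)
    define k where "k y = ((A y *v grad (\<Gamma> x) y) \<bullet> grad (\<Gamma> x) y) / (\<Gamma> x y)\<^sup>2" for y
    have M: "M_mean A \<Gamma> r u x = 1 / r * (LINT y:L_ball \<Gamma> r x|lborel. k y * u y)" for u
      unfolding M_mean_def k_def by (simp add: mult.commute)
    \<comment> \<open>The constant \<open>1\<close> solves \<open>L u = 0\<close>, so the kernel \<open>k\<close> has integral \<open>r \<noteq> 0\<close> over the ball;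
      this is the source of its integrability.\<close>
    have "Ck_on 2 UNIV (\<lambda>_::real^'n. 1)"
      using elementary_smooth[OF elementary.const] unfolding smooth_on_def by blast
    moreover have "L_op A b (\<lambda>_. 1) = (\<lambda>_. 0)"
      by (simp add: L_op_def dir_deriv_def fun_eq_iff)
    ultimately have "1 = M_mean A \<Gamma> r (\<lambda>_. 1) x"
      using Poisson_Jensen[of UNIV "\<lambda>_. 1" r x] \<open>r > 0\<close> by (simp add: N_mean_def)
    then have k_int: "set_integrable lborel (L_ball \<Gamma> r x) k"
      unfolding M set_integrable_def set_lebesgue_integral_def
      using not_integrable_integral_eq by fastforce
    have k_nonneg: "0 \<le> k y" for y
      using A_nonneg by (simp add: k_def)
    have "\<bar>M_mean A \<Gamma> r (potential \<Gamma> f) x - potential \<Gamma> f x + N_mean \<Gamma> r f x\<bar>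
        \<le> e * (M_mean A \<Gamma> r (potential \<Gamma> \<eta>) x + potential \<Gamma> \<eta> x + N_mean \<Gamma> r \<eta> x)"
      if "e > 0" for e
    proof -
      obtain \<phi> where \<phi>: "\<phi> \<in> test_functions UNIV" "\<And>x. \<bar>\<phi> x - f x\<bar> \<le> e * \<eta> x"
        using approx[OF \<open>e > 0\<close>] by blast
      have "L_op A b (potential \<Gamma> \<phi>) = (\<lambda>x. (- 1) * \<phi> x)"
        using Gamma_inverse(1)[OF \<phi>(1)] by auto
      then have PJ: "potential \<Gamma> \<phi> x = M_mean A \<Gamma> r (potential \<Gamma> \<phi>) x + N_mean \<Gamma> r \<phi> x"
        using Poisson_Jensen[OF open_UNIV Gamma_potential_C2[OF \<phi>(1)] \<open>r > 0\<close>, of x]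
          N_mean_cmult[of r "- 1" \<phi>] by simp
      have "\<bar>(LINT y:L_ball \<Gamma> r x|lborel. k y * potential \<Gamma> \<phi> y)
            - (LINT y:L_ball \<Gamma> r x|lborel. k y * potential \<Gamma> f y)\<bar>
          \<le> e * (LINT y:L_ball \<Gamma> r x|lborel. k y * potential \<Gamma> \<eta> y)"
        using k_nonneg open_L_ball bounded_L_ball[OF \<open>r > 0\<close>] C2_cont \<phi> \<eta> u_cont
        by (intro weighted_set_integral_diff_bound k_int potential_approx) auto
      then have "\<bar>M_mean A \<Gamma> r (potential \<Gamma> \<phi>) x - M_mean A \<Gamma> r (potential \<Gamma> f) x\<bar>
          \<le> e * M_mean A \<Gamma> r (potential \<Gamma> \<eta>) x"
        unfolding M right_diff_distrib[symmetric] abs_mult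
        using \<open>r > 0\<close> by (simp add: divide_right_mono)
      moreover have "\<bar>N_mean \<Gamma> r \<phi> x - N_mean \<Gamma> r f x\<bar> \<le> e * N_mean \<Gamma> r \<eta> x"
        using \<open>r > 0\<close> test_cont \<phi> \<eta> f_continuous by (intro N_mean_diff_bound) auto
      ultimately show ?thesis
        using PJ potential_approx[OF \<phi>, of x] by (simp add: ring_distribs abs_le_iff)
    qed
    then have "M_mean A \<Gamma> r (potential \<Gamma> f) x - potential \<Gamma> f x + N_mean \<Gamma> r f x = 0"
      by (rule real_eq_0_if_le_small_multiples)
    then show ?thesis by simp
  qed

  have "((\<lambda>r. (M_mean A \<Gamma> r (potential \<Gamma> f) x - potential \<Gamma> f x) / Q_mean \<Gamma> r x) \<longlongrightarrow> - f x)
      (at_right 0)" for x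
  proof (rule Lim_transform_eventually)
    show "((\<lambda>r. - (N_mean \<Gamma> r f x / Q_mean \<Gamma> r x)) \<longlongrightarrow> - f x) (at_right 0)"
      by (intro tendsto_minus pole_kernel.N_mean_quotient_tendsto[OF pole] f_continuous)
    show "\<forall>\<^sub>F r in at_right 0. - (N_mean \<Gamma> r f x / Q_mean \<Gamma> r x)
        = (M_mean A \<Gamma> r (potential \<Gamma> f) x - potential \<Gamma> f x) / Q_mean \<Gamma> r x"
      using eventually_at_right_less[of "0::real"]
      by (rule eventually_mono) (simp add: identity)
  qed
  then show ?thesis
    using u_cont f_continuous
    by (auto simp: asymptotic_average_solution_def intro!: continuous_intros)
qed

end
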